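(* Let $W$ be a separable Fréchet space with Borel sigma-algebra $\mathcal B(W)$ and let $H$ be a separable Hilbert space injected densely and continuously into $W$. Assume that $\rho$ and $\nu$ are spread probability measures on $W$ with $d_H(\rho,\nu)<\infty$ and that $U\rho=\nu$ for some measurable map $U:W\to W$. Let $T$ be the optimal transport map sending $\rho$ to $\nu$, with inverse $T^{-1}$ (see context). Then $R=T^{-1}\circ U$ is a $\rho$-rotation (i.e. $R\rho=\rho$) and $U=T\circ R$ $\rho$-almost surely; moreover, if $U$ is a perturbation of identity, then $R$ is also a perturbation of identity. In both cases, $R$ is the $\rho$-almost everywhere unique minimal $\rho$-rotation in the sense that $$\int_W|U(x)-R(x)|_H^2\,d\rho(x)=\inf_{R'\in\mathcal R}\int_W|U(x)-R'(x)|_H^2\,d\rho(x),$$ where $\mathcal R$ denotes the set of $\rho$-rotations.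
   Context: $U\rho$ denotes the image of $\rho$ under $U$. A $\rho$-rotation is a measurable map $R:W\to W$ with $R\rho=\rho$. A perturbation of identity is a map $W\to W$ of the form $I_W+\xi$ with $\xi\in H$ almost surely. $|x-y|_H=\infty$ if $x-y\notin H$. For probabilities $\xi,\eta$ on $W$, $\Sigma(\xi,\eta)$ is the set of probability measures on $W\times W$ with first marginal $\xi$ and second marginal $\eta$, and $d_H^2(\xi,\eta)=\inf\{\int_{W\times W}|x-y|_H^2\,d\beta(x,y):\beta\in\Sigma(\xi,\eta)\}$; the Monge–Kantorovitch problem for $\Sigma(\xi,\eta)$ asks for a $\beta$ attaining this infimum. Spread measure: a finite-dimensional orthogonal projection of $H$ is called regular if it has a continuous extension to $W$ (denoted by the same symbol). A probability $m$ on $W$ is spread if there is a sequence of finite-dimensional regular projections $(\pi_n,n\ge1)$ converging to $I_H$ (with $\pi_n$ of rank $n$) such that, with $\pi_n^\perp=I_W-\pi_n$, the regular conditional probabilities $m(\,\cdot\mid\pi_n^\perp=x_n^\perp)$, concentrated on the $n$-dimensional affine spaces $\pi_n(W)+x_n^\perp$, vanish on the sets of Hausdorff dimension $n-1$ for $\pi_n^\perp(m)$-almost all $x_n^\perp$ and for every $n\ge1$. Optimal transport map (known fact used to define $T$): for spread $\rho,\nu$ with $d_H(\rho,\nu)<\infty$, the Monge–Kantorovitch problem for $\Sigma(\rho,\nu)$ has a unique solution $\gamma$, and $\gamma=(I_W\times T)\rho$ for a ($\rho$-a.s. unique) Borel map $T=I_W+\xi$ with $\xi\in H$ $\rho$-a.s.;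 $T$ is the optimal transport map. It is invertible: there is a Borel map $T^{-1}=I_W+\eta$, $\eta\in H$ $\nu$-a.s., with $T^{-1}\circ T=I_W$ $\rho$-a.s. and $T\circ T^{-1}=I_W$ $\nu$-a.s. *)

theory Defs
  imports "HOL-Probability.Probability"
begin

text \<open>
  A Frechet space: a locally convex topological vector space whose topology is induced by a
  complete translation-invariant metric. The class fixes one such metric \<^const>\<open>dist\<close>, but
  below only the topology of the space is used. A class specification cannot mention
  \<^const>\<open>convex\<close> and the product topology, which are unfolded here and restored in the
  two lemmas that follow.
\<close>

class frechet_space = real_vector + complete_space +
  assumes dist_translation: "dist (x + z) (y + z) = dist x y"
    and tendsto_scaleR_nhds:
      "filterlim (\<lambda>(c, y). scaleR c y) (nhds (scaleR a x)) (prod_filter (nhds a) (nhds x))"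
    and locally_convex_unfolded:
      "open V \<Longrightarrow> 0 \<in> V \<Longrightarrow>
        \<exists>C. open C \<and>
            (\<forall>x\<in>C. \<forall>y\<in>C. \<forall>u\<ge>0. \<forall>v\<ge>0. u + v = 1 \<longrightarrow> scaleR u x + scaleR v y \<in> C) \<and>
            0 \<in> C \<and> C \<subseteq> V"

lemma frechet_continuous_scaleR:
  "continuous_on UNIV (\<lambda>(a, x :: 'w::frechet_space). a *\<^sub>R x)"
  unfolding continuous_on_def
  by (auto simp: nhds_prod[symmetric] split_def
      intro!: filterlim_mono[OF tendsto_scaleR_nhds order_refl, unfolded nhds_prod[symmetric] split_def]
        at_within_le_nhds)

lemma frechet_locally_convex:
  fixes V :: "'w::frechet_space set"
  shows "open V \<Longrightarrow> 0 \<in> V \<Longrightarrow> \<exists>C. open C \<and> convex C \<and> 0 \<in> C \<and> C \<subseteq> V"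
  using locally_convex_unfolded[of V] unfolding convex_def by blast

text \<open>
  The Hilbert space is a separate type, and its inclusion into \<open>W\<close> is an explicit map \<open>j\<close>;
  thus ``\<open>x \<in> H\<close>'' for \<open>x\<close> in \<open>W\<close> reads \<open>x \<in> range j\<close>.
\<close>

definition dense_continuous_injection ::
    "('h::{real_inner,complete_space} \<Rightarrow> 'w::frechet_space) \<Rightarrow> bool" where
  "dense_continuous_injection j \<longleftrightarrow>
     linear j \<and> inj j \<and> continuous_on UNIV j \<and> closure (range j) = UNIV"

definition Hnorm ::
    "('h::{real_inner,complete_space} \<Rightarrow> 'w::frechet_space) \<Rightarrow> 'w \<Rightarrow> ennreal" where
  "Hnorm j x = (if x \<in> range j then ennreal (norm (inv j x)) else \<infinity>)"

definition perturbation_of_identity ::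
    "('h::{real_inner,complete_space} \<Rightarrow> 'w::frechet_space) \<Rightarrow> 'w measure \<Rightarrow> ('w \<Rightarrow> 'w) \<Rightarrow> bool" where
  "perturbation_of_identity j m F \<longleftrightarrow> (AE x in m. F x - x \<in> range j)"

definition rotations :: "'w::topological_space measure \<Rightarrow> ('w \<Rightarrow> 'w) set" where
  "rotations m = {R. R \<in> borel \<rightarrow>\<^sub>M borel \<and> distr m borel R = m}"


subsection \<open>The Monge-Kantorovitch problem\<close>

definition couplings ::
    "'w::topological_space measure \<Rightarrow> 'w measure \<Rightarrow> ('w \<times> 'w) measure set" where
  "couplings \<xi> \<eta> =
     {\<beta>. prob_space \<beta> \<and> sets \<beta> = sets (borel \<Otimes>\<^sub>M borel) \<and>
         distr \<beta> borel fst = \<xi> \<and> distr \<beta> borel snd = \<eta>}"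

definition transport_cost ::
    "('h::{real_inner,complete_space} \<Rightarrow> 'w::frechet_space) \<Rightarrow> ('w \<times> 'w) measure \<Rightarrow> ennreal" where
  "transport_cost j \<beta> = (\<integral>\<^sup>+(x, y). (Hnorm j (x - y))\<^sup>2 \<partial>\<beta>)"

text \<open>The square of the distance \<open>d\<^sub>H\<close>.\<close>

definition dH2 ::
    "('h::{real_inner,complete_space} \<Rightarrow> 'w::frechet_space) \<Rightarrow> 'w measure \<Rightarrow> 'w measure \<Rightarrow> ennreal" where
  "dH2 j \<xi> \<eta> = (INF \<beta>\<in>couplings \<xi> \<eta>. transport_cost j \<beta>)"

definition MK_solutions ::
    "('h::{real_inner,complete_space} \<Rightarrow> 'w::frechet_space) \<Rightarrow>
       'w measure \<Rightarrow> 'w measure \<Rightarrow> ('w \<times> 'w) measure set" where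
  "MK_solutions j \<xi> \<eta> = {\<beta> \<in> couplings \<xi> \<eta>. transport_cost j \<beta> = dH2 j \<xi> \<eta>}"

text \<open>
  \<open>T\<close> is (a version of) the optimal transport map from \<open>\<rho>\<close> to \<open>\<nu>\<close>: the Monge-Kantorovitch
  problem has a unique solution, that solution is the image of \<open>\<rho>\<close> under \<open>I \<times> T\<close>, and
  \<open>T - I\<close> is almost surely \<open>H\<close>-valued. For spread measures at finite distance such a map exists.
\<close>

definition optimal_transport_map ::
    "('h::{real_inner,complete_space} \<Rightarrow> 'w::frechet_space) \<Rightarrow>
       'w measure \<Rightarrow> 'w measure \<Rightarrow> ('w \<Rightarrow> 'w) \<Rightarrow> bool" where
  "optimal_transport_map j \<rho> \<nu> T \<longleftrightarrow>
     T \<in> borel \<rightarrow>\<^sub>M borel \<and> perturbation_of_identity j \<rho> T \<and>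
     MK_solutions j \<rho> \<nu> = {distr \<rho> (borel \<Otimes>\<^sub>M borel) (\<lambda>x. (x, T x))}"

definition inverse_transport_map ::
    "('h::{real_inner,complete_space} \<Rightarrow> 'w::frechet_space) \<Rightarrow>
       'w measure \<Rightarrow> 'w measure \<Rightarrow> ('w \<Rightarrow> 'w) \<Rightarrow> ('w \<Rightarrow> 'w) \<Rightarrow> bool" where
  "inverse_transport_map j \<rho> \<nu> T S \<longleftrightarrow>
     S \<in> borel \<rightarrow>\<^sub>M borel \<and> perturbation_of_identity j \<nu> S \<and>
     (AE x in \<rho>. S (T x) = x) \<and> (AE y in \<nu>. T (S y) = y)"


subsection \<open>Hausdorff dimension\<close>

text \<open>
  \<open>hausdorff_measure s\<close> is only used for \<open>s > 0\<close>, so sets of diameter \<open>0\<close> contribute \<open>0\<close> and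
  the convention for \<open>0\<close> to the power \<open>0\<close> is immaterial. Boundedness is needed because
  \<^const>\<open>diameter\<close> is a junk value on unbounded sets. The empty set has dimension \<open>0\<close>.
\<close>

definition hausdorff_content :: "real \<Rightarrow> real \<Rightarrow> 'a::metric_space set \<Rightarrow> ennreal" where
  "hausdorff_content s \<delta> A =
     (INF C\<in>{C :: nat \<Rightarrow> 'a set. A \<subseteq> (\<Union>i. C i) \<and> (\<forall>i. bounded (C i) \<and> diameter (C i) \<le> \<delta>)}.
        (\<Sum>i. ennreal (diameter (C i) powr s)))"

definition hausdorff_measure :: "real \<Rightarrow> 'a::metric_space set \<Rightarrow> ennreal" where
  "hausdorff_measure s A = (SUP \<delta>\<in>{0<..}. hausdorff_content s \<delta> A)"

definition hausdorff_dim :: "'a::metric_space set \<Rightarrow> ennreal" where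
  "hausdorff_dim A = Inf {ennreal s | s. s > 0 \<and> hausdorff_measure s A = 0}"


subsection \<open>Spread measures\<close>

definition orthogonal_projection_of_rank ::
    "nat \<Rightarrow> ('h::{real_inner,complete_space} \<Rightarrow> 'h) \<Rightarrow> bool" where
  "orthogonal_projection_of_rank n P \<longleftrightarrow>
     bounded_linear P \<and> (\<forall>x. P (P x) = P x) \<and> (\<forall>x y. inner (P x) y = inner x (P y)) \<and>
     (\<exists>B. finite B \<and> span B = range P) \<and> dim (range P) = n"

text \<open>
  Since \<open>j\<close> has dense range, the continuous extension \<open>p\<close> of a regular projection \<open>P\<close> is
  unique, and it maps into the finite-dimensional space \<open>range P\<close>.
\<close>

definition continuous_extension ::
    "('h::{real_inner,complete_space} \<Rightarrow> 'w::frechet_space) \<Rightarrow> ('h \<Rightarrow> 'h) \<Rightarrow> ('w \<Rightarrow> 'h) \<Rightarrow> bool" where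
  "continuous_extension j P p \<longleftrightarrow> continuous_on UNIV p \<and> (\<forall>h. p (j h) = P h)"

definition perp ::
    "('h::{real_inner,complete_space} \<Rightarrow> 'w::frechet_space) \<Rightarrow> ('w \<Rightarrow> 'h) \<Rightarrow> 'w \<Rightarrow> 'w" where
  "perp j p x = x - j (p x)"

text \<open>\<open>K y\<close> is the conditional probability \<open>m(\<cdot> | f = y)\<close>.\<close>

definition regular_conditional_probability ::
    "'w::topological_space measure \<Rightarrow> ('w \<Rightarrow> 'w) \<Rightarrow> ('w \<Rightarrow> 'w measure) \<Rightarrow> bool" where
  "regular_conditional_probability m f K \<longleftrightarrow>
     K \<in> borel \<rightarrow>\<^sub>M prob_algebra borel \<and>
     (\<forall>A\<in>sets borel. \<forall>B\<in>sets borel.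
        emeasure m (A \<inter> f -` B) = (\<integral>\<^sup>+y\<in>B. emeasure (K y) A \<partial>distr m borel f))"

text \<open>
  The fibre of \<open>perp j (p n)\<close> over \<open>y\<close> is the \<open>n\<close>-dimensional affine space \<open>\<pi>\<^sub>n(W) + y\<close>, on which
  the conditional probability is concentrated for almost every \<open>y\<close>. The Hausdorff dimension of a
  subset is taken for the Euclidean distance of \<open>H\<close>, i.e. after the affine
  identification \<open>p n\<close> of the fibre with \<open>range (\<pi> n)\<close>; the metric of \<open>W\<close> would not do, being
  determined only up to its uniformity. Projections converge pointwise.
\<close>

definition spread ::
    "('h::{real_inner,complete_space} \<Rightarrow> 'w::frechet_space) \<Rightarrow> 'w measure \<Rightarrow> bool" where
  "spread j m \<longleftrightarrow>
     (\<exists>(\<pi> :: nat \<Rightarrow> 'h \<Rightarrow> 'h) (p :: nat \<Rightarrow> 'w \<Rightarrow> 'h).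
        (\<forall>h. (\<lambda>n. \<pi> n h) \<longlonglongrightarrow> h) \<and>
        (\<forall>n\<ge>1. orthogonal_projection_of_rank n (\<pi> n) \<and> continuous_extension j (\<pi> n) (p n) \<and>
           (\<exists>K. regular_conditional_probability m (perp j (p n)) K \<and>
              (AE y in distr m borel (perp j (p n)).
                 \<forall>A\<in>sets borel.
                   A \<subseteq> {x. perp j (p n) x = y} \<and> hausdorff_dim (p n ` A) = of_nat (n - 1) \<longrightarrow>
                   emeasure (K y) A = 0))))"

end

theory Submission
  imports Defs
begin

text \<open>
  The coupling of \<open>R'\<close> and \<open>U\<close> under \<open>\<rho>\<close> has marginals \<open>\<rho>\<close> and \<open>\<nu>\<close> for every \<open>\<rho>\<close>-rotation \<open>R'\<close>, so
  the cost of \<open>R'\<close> is at least the squared distance of \<open>\<rho>\<close> and \<open>\<nu>\<close>, which \<open>R = T\<^sup>-\<^sup>1 \<circ> U\<close> attains.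
  Conversely, for a minimal \<open>R'\<close> this coupling is the unique optimal one, which is concentrated
  on the pairs \<open>(x, y)\<close> with \<open>T\<^sup>-\<^sup>1 y = x\<close>. The costs may be pushed forward because the \<open>H\<close>-norm is
  lower semicontinuous on \<open>W\<close>.
\<close>

subsection \<open>The $H$-norm on $W$\<close>

text \<open>
  This replaces weak compactness of balls: the points of almost minimal norm
  in the sets \<open>C n\<close> form a nested sequence with diameters tending to \<open>0\<close>.
\<close>

lemma decreasing_closed_convex_nest:
  fixes C :: "nat \<Rightarrow> 'h::{real_inner,complete_space} set"
  assumes cl: "\<And>n. closed (C n)" and cv: "\<And>n. convex (C n)" and ne: "\<And>n. C n \<noteq> {}"
    and dec: "decseq C" and bd: "bounded (C 0)"
  shows "(\<Inter>n. C n) \<noteq> {}"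
proof -
  obtain M where M: "\<And>x. x \<in> C 0 \<Longrightarrow> norm x \<le> M"
    using bd unfolding bounded_iff by blast
  \<comment> \<open>\<open>a n\<close> is the squared distance of the origin from
    \<open>C n\<close>. It increases with \<open>n\<close> and is bounded, hence converges to
    \<open>A\<close>.\<close>
  define a where "a n = (INF x\<in>C n. (norm x)\<^sup>2)" for n
  have bb: "bdd_below ((\<lambda>x. (norm x)\<^sup>2) ` C n)" for n
    by (rule bdd_belowI[of _ 0]) auto
  have a_le: "a n \<le> (norm x)\<^sup>2" if "x \<in> C n" for x n
    unfolding a_def using bb that by (rule cINF_lower)
  have mono: "incseq a"
    unfolding a_def using ne bb dec
    by (intro incseq_SucI cINF_superset_mono) (auto simp: decseq_Suc_iff)
  have a_bd: "a n \<le> M\<^sup>2" for n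
  proof -
    obtain x where x: "x \<in> C n" using ne by blast
    then have "x \<in> C 0" using decseqD[OF dec, of 0 n] by auto
    then have "(norm x)\<^sup>2 \<le> M\<^sup>2" using M by (simp add: power_mono)
    with a_le[OF x] show ?thesis by linarith
  qed
  obtain A where A: "a \<longlonglongrightarrow> A" "\<And>n. a n \<le> A"
    using incseq_convergent[OF mono, of "M\<^sup>2"] a_bd by blast
  \<comment> \<open>The bound uses the common limit \<open>A\<close>, not \<open>a n\<close>, so
    that the sets stay nested; since \<open>a n \<le> A\<close>, the positive slack keeps each of
    them nonempty.\<close>
  define S where "S n = C n \<inter> {x. (norm x)\<^sup>2 \<le> A + 1 / real (Suc n)}" for n
  have "\<exists>x. \<forall>n. x \<in> S n"
  proof (rule decreasing_closed_nest)
    show "closed (S n)" for n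
      unfolding S_def using cl by (intro closed_Int closed_Collect_le continuous_intros) auto
  next
    fix n
    have "a n < A + 1 / real (Suc n)"
      by (rule le_less_trans[OF A(2)]) simp
    then obtain x where "x \<in> C n" "(norm x)\<^sup>2 < A + 1 / real (Suc n)"
      unfolding a_def using cINF_less_iff[OF ne bb] by blast
    then show "S n \<noteq> {}" unfolding S_def by force
  next
    fix m n :: nat assume "m \<le> n"
    moreover from this have "1 / real (Suc n) \<le> 1 / real (Suc m)"
      by (simp add: frac_le)
    ultimately show "S n \<subseteq> S m"
      unfolding S_def using decseqD[OF dec, of m n] by auto
  next
    fix e :: real assume "0 < e"
    \<comment> \<open>This quantity bounds the squared distance of two points of \<open>S n\<close>:
      their midpoint lies in \<open>C n\<close>, so \<open>4 * a n\<close> is at most the squared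
      norm of their sum, and the parallelogram law applies.\<close>
    have "(\<lambda>n. 4 * (A + 1 / real (Suc n)) - 4 * a n) \<longlonglongrightarrow> 4 * (A + 0) - 4 * A"
      using LIMSEQ_inverse_real_of_nat
      by (intro tendsto_intros A) (simp add: inverse_eq_divide)
    then have "\<forall>\<^sub>F n in sequentially. 4 * (A + 1 / real (Suc n)) - 4 * a n < e\<^sup>2"
      using \<open>0 < e\<close> by (intro order_tendstoD) auto
    then obtain n where n: "4 * (A + 1 / real (Suc n)) - 4 * a n < e\<^sup>2"
      by (auto simp: eventually_sequentially)
    have "dist x y < e" if "x \<in> S n" "y \<in> S n" for x y
    proof -
      define b where "b = A + 1 / real (Suc n)"
      have "(1/2) *\<^sub>R x + (1/2) *\<^sub>R y \<in> C n"
        using that cv[of n] unfolding S_def by (intro convexD) auto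
      from a_le[OF this] have "4 * a n \<le> (norm (x + y))\<^sup>2"
        by (simp add: scaleR_add_right[symmetric] power_divide)
      moreover have "(norm (x - y))\<^sup>2 = 2 * (norm x)\<^sup>2 + 2 * (norm y)\<^sup>2 - (norm (x + y))\<^sup>2"
        by (simp add: power2_norm_eq_inner algebra_simps inner_commute)
      moreover have "(norm x)\<^sup>2 \<le> b" "(norm y)\<^sup>2 \<le> b"
        using that unfolding S_def b_def by auto
      ultimately have "(norm (x - y))\<^sup>2 < e\<^sup>2" using n[folded b_def] by linarith
      then show ?thesis
        using \<open>0 < e\<close> by (simp add: dist_norm power_less_imp_less_base)
    qed
    then show "\<exists>n. \<forall>x\<in>S n. \<forall>y\<in>S n. dist x y < e" by blast
  qed blast
  then show ?thesis unfolding S_def by blast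
qed

section \<open>Continuity and measurability of subtraction in a Frechet space\<close>

lemma frechet_dist_diff_zero: "dist (x - y) 0 = dist x (y :: 'w::frechet_space)"
  using dist_translation[of "x - y" y 0] by simp

lemma frechet_dist_diff_le:
  fixes x :: "'w::frechet_space"
  shows "dist (x - y) (x' - y') \<le> dist x x' + dist y y'"
proof -
  have "dist (x - y) (x' - y) = dist x x'"
    using dist_translation[of "x - y" y "x' - y"] by simp
  moreover have "dist (x' - y) (x' - y') = dist y y'"
    \<comment> \<open>This translation carries \<open>x' - y\<close> to \<open>y'\<close> and
      \<open>x' - y'\<close> to \<open>y\<close>.\<close>
    using dist_translation[of "x' - y" "y + y' - x'" "x' - y'"]
    by (simp add: dist_commute algebra_simps)
  ultimately show ?thesis
    using dist_triangle[of "x - y" "x' - y'" "x' - y"] by simp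
qed

lemma frechet_tendsto_diff:
  fixes f g :: "'a \<Rightarrow> 'w::frechet_space"
  assumes "(f \<longlongrightarrow> a) F" "(g \<longlongrightarrow> b) F"
  shows "((\<lambda>x. f x - g x) \<longlongrightarrow> a - b) F"
proof -
  have "((\<lambda>x. dist (f x) a + dist (g x) b) \<longlongrightarrow> dist a a + dist b b) F"
    using assms by (intro tendsto_intros)
  then have "((\<lambda>x. dist (f x) a + dist (g x) b) \<longlongrightarrow> 0) F" by simp
  then show ?thesis
    unfolding tendsto_dist_iff[of _ "a - b"]
    by (rule tendsto_0_le[where K = 1]) (auto intro!: always_eventually frechet_dist_diff_le)
qed

lemma frechet_borel_measurable_diff:
  fixes f g :: "'a \<Rightarrow> 'w::{frechet_space,second_countable_topology}"
  assumes "f \<in> borel_measurable M" "g \<in> borel_measurable M"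
  shows "(\<lambda>x. f x - g x) \<in> borel_measurable M"
proof (rule borel_measurable_continuous_Pair[OF assms])
  show "continuous_on UNIV (\<lambda>x :: 'w \<times> 'w. fst x - snd x)"
    unfolding continuous_on_def by (intro ballI frechet_tendsto_diff tendsto_intros)
qed

text \<open>This is the lower semicontinuity of the \<open>H\<close>-norm on \<open>W\<close>. If
  \<open>j (h n)\<close> tends to \<open>w\<close>, the closed convex hulls of the tails of
  \<open>h\<close> share a point \<open>x\<close> of the ball, and local convexity of
  \<open>W\<close> forces \<open>j x = w\<close>.\<close>

lemma closed_image_cball:
  fixes j :: "'h::{real_inner,complete_space} \<Rightarrow> 'w::frechet_space"
  assumes lin: "linear j" and cont: "continuous_on UNIV j"
  shows "closed (j ` cball 0 r)"
  unfolding closed_sequential_limits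
proof (intro allI impI, elim conjE)
  fix s w assume "\<forall>n. s n \<in> j ` cball 0 r" and lim: "s \<longlonglongrightarrow> w"
  then have "\<forall>n. \<exists>x. x \<in> cball 0 r \<and> s n = j x" by blast
  then obtain h where h: "\<And>n. h n \<in> cball 0 r" and s: "\<And>n. s n = j (h n)" by metis
  define C where "C n = closure (convex hull (h ` {n..}))" for n
  have C_cball: "C n \<subseteq> cball 0 r" for n
    unfolding C_def using h by (intro closure_minimal hull_minimal) auto
  have "(\<Inter>n. C n) \<noteq> {}"
  proof (rule decreasing_closed_convex_nest)
    show "decseq C"
      unfolding C_def decseq_def by (auto intro!: closure_mono hull_mono image_mono)
    show "bounded (C 0)"
      using C_cball bounded_cball bounded_subset by blast
  qed (auto simp: C_def convex_closure)
  then obtain x where x: "\<And>n. x \<in> C n" by auto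
  have "dist (j x) w \<le> e" if "0 < e" for e
  proof -
    obtain B :: "'w set" where B: "open B" "convex B" "0 \<in> B" "B \<subseteq> ball 0 e"
      using frechet_locally_convex[OF open_ball, of "0 :: 'w" e] \<open>0 < e\<close> by auto
    have "(\<lambda>n. s n - w) \<longlonglongrightarrow> w - w"
      by (rule frechet_tendsto_diff[OF lim tendsto_const])
    then have "\<forall>\<^sub>F n in sequentially. s n - w \<in> B"
      by (rule topological_tendstoD) (simp_all add: B)
    then obtain n where n: "\<And>k. n \<le> k \<Longrightarrow> j (h k) - w \<in> B"
      unfolding eventually_sequentially s by blast
    \<comment> \<open>Metric balls of \<open>W\<close> need not be convex, whence the convex
      \<open>B\<close> inside one: its preimage contains a tail of \<open>h\<close> and therefore
      the convex hull of that tail.\<close>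
    have "convex {z. j z - w \<in> B}"
    proof (rule convexI)
      fix y z and u v :: real
      assume *: "y \<in> {z. j z - w \<in> B}" "z \<in> {z. j z - w \<in> B}" "0 \<le> u" "0 \<le> v" "u + v = 1"
      have "u *\<^sub>R (j y - w) + v *\<^sub>R (j z - w) = u *\<^sub>R j y + v *\<^sub>R j z - (u + v) *\<^sub>R w"
        by (simp only: scaleR_diff_right scaleR_add_left) simp
      also have "\<dots> = j (u *\<^sub>R y + v *\<^sub>R z) - w"
        using * lin by (simp add: linear_add linear_scale)
      finally show "u *\<^sub>R y + v *\<^sub>R z \<in> {z. j z - w \<in> B}"
        using convexD[OF \<open>convex B\<close>, of "j y - w" "j z - w" u v] * by simp
    qed
    then have "convex hull (h ` {n..}) \<subseteq> {z. j z - w \<in> B}"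
      using n by (intro hull_minimal) auto
    \<comment> \<open>\<open>B\<close> is open, so a closed condition is substituted before passing
      to the closure \<open>C n\<close>.\<close>
    also have "\<dots> \<subseteq> {z. dist (j z) w \<le> e}"
      using B(4) by (force simp: dist_commute[of 0] frechet_dist_diff_zero)
    finally have "C n \<subseteq> {z. dist (j z) w \<le> e}"
      unfolding C_def using cont
      by (intro closure_minimal closed_Collect_le continuous_intros) auto
    then show ?thesis using x by blast
  qed
  then have "j x = w" by (metis dense_ge dist_le_zero_iff)
  then show "w \<in> j ` cball 0 r" using x C_cball by blast
qed

lemma Hnorm_le_ennreal_iff:
  assumes "inj j" "0 \<le> r"
  shows "Hnorm j x \<le> ennreal r \<longleftrightarrow> x \<in> j ` cball 0 r"
  using assms by (auto simp: Hnorm_def inj_image_mem_iff top_unique)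

text \<open>Sublevel sets at finite levels are images of closed balls, hence closed; at level
  infinity the sublevel set is all of \<open>W\<close>.\<close>

lemma borel_measurable_Hnorm:
  assumes "dense_continuous_injection j"
  shows "Hnorm j \<in> borel_measurable borel"
proof (rule borel_measurableI_le)
  fix y :: ennreal
  show "{x \<in> space borel. Hnorm j x \<le> y} \<in> sets borel"
  proof (cases y)
    case (real r)
    then have "{x \<in> space borel. Hnorm j x \<le> y} = j ` cball 0 r"
      using assms Hnorm_le_ennreal_iff[of j r] by (auto simp: dense_continuous_injection_def)
    then show ?thesis
      using assms by (simp add: dense_continuous_injection_def closed_image_cball)
  qed auto
qed

lemma Hnorm_minus_commute:
  assumes "dense_continuous_injection j"
  shows "Hnorm j (x - y) = Hnorm j (y - x)"
proof -
  have inj: "inj j" and neg: "j (- h) = - j h" for h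
    using assms by (simp_all add: dense_continuous_injection_def linear_neg)
  have "Hnorm j (- z) = Hnorm j z" for z
  proof (cases "z \<in> range j")
    case True
    then obtain h where z: "z = j h" by blast
    then show ?thesis
      using inj unfolding Hnorm_def z neg[symmetric] by (simp add: inv_f_f)
  next
    case False
    have "- z \<notin> range j"
    proof
      assume "- z \<in> range j"
      then obtain h where "- z = j h" by blast
      then have "z = j (- h)" by (simp add: neg flip: \<open>- z = j h\<close>)
      with False show False by blast
    qed
    with False show ?thesis by (simp add: Hnorm_def)
  qed
  from this[of "y - x"] show ?thesis by simp
qed

subsection \<open>Couplings induced by maps\<close>

lemma distr_pair_couplings:
  assumes "prob_space \<rho>" "F \<in> \<rho> \<rightarrow>\<^sub>M borel" "G \<in> \<rho> \<rightarrow>\<^sub>M borel"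
  shows "distr \<rho> (borel \<Otimes>\<^sub>M borel) (\<lambda>x. (F x, G x)) \<in> couplings (distr \<rho> borel F) (distr \<rho> borel G)"
  using assms by (auto simp: couplings_def distr_distr comp_def intro!: prob_space.prob_space_distr)

lemma transport_cost_distr_pair:
  fixes j :: "'h::{real_inner,complete_space} \<Rightarrow> 'w::{frechet_space,second_countable_topology}"
  assumes "dense_continuous_injection j" "F \<in> \<rho> \<rightarrow>\<^sub>M borel" "G \<in> \<rho> \<rightarrow>\<^sub>M borel"
  shows "transport_cost j (distr \<rho> (borel \<Otimes>\<^sub>M borel) (\<lambda>x. (F x, G x))) =
    (\<integral>\<^sup>+x. (Hnorm j (F x - G x))\<^sup>2 \<partial>\<rho>)"
proof -
  have "(\<lambda>z :: 'w \<times> 'w. Hnorm j (fst z - snd z)) \<in> borel_measurable (borel \<Otimes>\<^sub>M borel)"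
    by (intro measurable_compose[OF _ borel_measurable_Hnorm[OF assms(1)]]
        frechet_borel_measurable_diff) auto
  then show ?thesis
    using assms(2,3) by (simp add: transport_cost_def case_prod_unfold nn_integral_distr)
qed

section \<open>Rotations as couplings, and uniqueness of the optimal one\<close>

theorem theorem6p9:
  fixes j :: "'h::{real_inner,complete_space,second_countable_topology} \<Rightarrow>
                'w::{frechet_space,second_countable_topology}"
    and \<rho> \<nu> :: "'w measure"
    and U T Tinv R :: "'w \<Rightarrow> 'w"
  assumes "dense_continuous_injection j"
    and "prob_space \<rho>" and "sets \<rho> = sets borel" and "spread j \<rho>"
    and "prob_space \<nu>" and "sets \<nu> = sets borel" and "spread j \<nu>"
    and "dH2 j \<rho> \<nu> < \<infinity>"
    and "U \<in> borel \<rightarrow>\<^sub>M borel" and "distr \<rho> borel U = \<nu>"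
    and "optimal_transport_map j \<rho> \<nu> T"
    and "inverse_transport_map j \<rho> \<nu> T Tinv"
    and "R = Tinv \<circ> U"
  shows "R \<in> rotations \<rho> \<and>
    (AE x in \<rho>. U x = (T \<circ> R) x) \<and>
    (perturbation_of_identity j \<rho> U \<longrightarrow> perturbation_of_identity j \<rho> R) \<and>
    (\<integral>\<^sup>+x. (Hnorm j (U x - R x))\<^sup>2 \<partial>\<rho>) =
      (INF R'\<in>rotations \<rho>. \<integral>\<^sup>+x. (Hnorm j (U x - R' x))\<^sup>2 \<partial>\<rho>) \<and>
    (\<forall>R0\<in>rotations \<rho>.
       (\<integral>\<^sup>+x. (Hnorm j (U x - R0 x))\<^sup>2 \<partial>\<rho>) =
         (INF R'\<in>rotations \<rho>. \<integral>\<^sup>+x. (Hnorm j (U x - R' x))\<^sup>2 \<partial>\<rho>) \<longrightarrow>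
       (AE x in \<rho>. R0 x = R x))"
proof -
  note j = assms(1) and \<rho> = assms(2) and R_eq = assms(13)
  have linj: "linear j" using j by (simp add: dense_continuous_injection_def)
  have \<rho>_meas: "f \<in> \<rho> \<rightarrow>\<^sub>M borel" if "f \<in> borel \<rightarrow>\<^sub>M borel" for f :: "'w \<Rightarrow> 'w"
    using that measurable_cong_sets[OF assms(3) refl] by blast
  have U: "U \<in> borel \<rightarrow>\<^sub>M borel" and U\<nu>: "distr \<rho> borel U = \<nu>"
    using assms(9,10) .
  define \<gamma> where "\<gamma> = distr \<rho> (borel \<Otimes>\<^sub>M borel) (\<lambda>x. (x, T x))"
  have T: "T \<in> borel \<rightarrow>\<^sub>M borel" and MK: "MK_solutions j \<rho> \<nu> = {\<gamma>}"
    using assms(11) by (simp_all add: optimal_transport_map_def \<gamma>_def)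
  have S: "Tinv \<in> borel \<rightarrow>\<^sub>M borel" and S_pert: "AE y in \<nu>. Tinv y - y \<in> range j"
    and ST: "AE x in \<rho>. Tinv (T x) = x" and TS: "AE y in \<nu>. T (Tinv y) = y"
    using assms(12) by (simp_all add: inverse_transport_map_def perturbation_of_identity_def)
  have R: "R \<in> borel \<rightarrow>\<^sub>M borel" using U S R_eq by simp
  have AE_U: "AE x in \<rho>. P (U x)" if "AE y in \<nu>. P y" for P
    using AE_distrD[OF \<rho>_meas[OF U]] that unfolding U\<nu> by blast
  have id: "distr \<rho> borel (\<lambda>x. x) = \<rho>"
    using assms(3) distr_id2 by metis
  have \<gamma>_MK: "\<gamma> \<in> MK_solutions j \<rho> \<nu>" using MK by simp
  \<comment> \<open>That \<open>T\<close> sends \<open>\<rho>\<close> to \<open>\<nu>\<close> is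
    read off the second marginal of the coupling \<open>\<gamma>\<close>.\<close>
  have T\<nu>: "distr \<rho> borel T = \<nu>"
    using \<gamma>_MK \<rho>_meas[OF T] \<rho>_meas[OF measurable_ident]
    by (simp add: MK_solutions_def couplings_def \<gamma>_def distr_distr comp_def id_def)

  \<comment> \<open>\<open>U\<close> and \<open>T\<close> have the same image measure
    \<open>\<nu>\<close>, so composing either with \<open>Tinv\<close> gives the same image of
    \<open>\<rho>\<close>; for \<open>T\<close> the composite is almost surely the identity.\<close>
  have "distr \<rho> borel R = distr \<nu> borel Tinv"
    unfolding U\<nu>[symmetric] R_eq using S \<rho>_meas[OF U] by (simp add: distr_distr)
  also have "\<dots> = distr \<rho> borel (\<lambda>x. Tinv (T x))"
    unfolding T\<nu>[symmetric] using S \<rho>_meas[OF T] by (simp add: distr_distr comp_def)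
  also have "\<dots> = distr \<rho> borel (\<lambda>x. x)"
    using ST \<rho>_meas[OF measurable_compose[OF T S]] \<rho>_meas[OF measurable_ident]
    by (intro distr_cong_AE) (simp_all add: id_def)
  finally have R_rot: "R \<in> rotations \<rho>" using R id by (simp add: rotations_def)

  have pert: "perturbation_of_identity j \<rho> R" if "perturbation_of_identity j \<rho> U"
    using AE_U[OF S_pert] that unfolding perturbation_of_identity_def
  proof eventually_elim
    case (elim x)
    then have "(Tinv (U x) - U x) + (U x - x) \<in> range j"
      using linear_subspace_image[OF linj subspace_UNIV] by (rule subspace_add[rotated])
    then show ?case by (simp add: R_eq)
  qed

  define c where "c R' = (\<integral>\<^sup>+x. (Hnorm j (U x - R' x))\<^sup>2 \<partial>\<rho>)" for R' :: "'w \<Rightarrow> 'w"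
  define \<beta> where "\<beta> R' = distr \<rho> (borel \<Otimes>\<^sub>M borel) (\<lambda>x. (R' x, U x))" for R' :: "'w \<Rightarrow> 'w"
  have \<beta>: "\<beta> R' \<in> couplings \<rho> \<nu>" "transport_cost j (\<beta> R') = c R'" if "R' \<in> rotations \<rho>" for R' :: "'w \<Rightarrow> 'w"
  proof -
    have R': "R' \<in> borel \<rightarrow>\<^sub>M borel" "distr \<rho> borel R' = \<rho>"
      using that by (auto simp: rotations_def)
    show "\<beta> R' \<in> couplings \<rho> \<nu>"
      using distr_pair_couplings[OF \<rho> \<rho>_meas[OF R'(1)] \<rho>_meas[OF U]] by (simp add: \<beta>_def R' U\<nu>)
    show "transport_cost j (\<beta> R') = c R'"
      unfolding \<beta>_def transport_cost_distr_pair[OF j \<rho>_meas[OF R'(1)] \<rho>_meas[OF U]]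
      by (simp add: c_def Hnorm_minus_commute[OF j])
  qed
  have ge: "dH2 j \<rho> \<nu> \<le> c R'" if "R' \<in> rotations \<rho>" for R' :: "'w \<Rightarrow> 'w"
    using \<beta>[OF that] unfolding dH2_def by (metis INF_lower)

  \<comment> \<open>Concentration is stated through \<open>Tinv\<close> rather than
    \<open>T\<close>: once \<open>\<beta> R0 = \<gamma>\<close>, it pulls back along
    \<open>(R0, U)\<close> to \<open>Tinv (U x) = R0 x\<close>.\<close>
  have \<gamma>_conc: "AE z in \<gamma>. Tinv (snd z) = fst z"
    unfolding \<gamma>_def using ST S T \<rho>_meas[OF T] \<rho>_meas[OF measurable_ident]
    by (subst AE_distr_iff) (auto simp: id_def)
  \<comment> \<open>Both measures are the image of \<open>\<nu>\<close> under
    \<open>y \<mapsto> (Tinv y, y)\<close>, reached through \<open>T\<close> for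
    \<open>\<gamma>\<close> and through \<open>U\<close> for \<open>\<beta> R\<close>.\<close>
  have "\<beta> R = \<gamma>"
  proof -
    have "\<gamma> = distr \<rho> (borel \<Otimes>\<^sub>M borel) (\<lambda>x. (Tinv (T x), T x))"
      unfolding \<gamma>_def using ST
      by (intro distr_cong_AE)
        (auto simp: assms(3) intro!: measurable_Pair \<rho>_meas S T
          measurable_compose[OF T S] measurable_ident_sets)
    also have "\<dots> = distr \<nu> (borel \<Otimes>\<^sub>M borel) (\<lambda>y. (Tinv y, y))"
      unfolding T\<nu>[symmetric] using S \<rho>_meas[OF T] by (simp add: distr_distr comp_def)
    also have "\<dots> = \<beta> R"
      unfolding \<beta>_def U\<nu>[symmetric] R_eq using S \<rho>_meas[OF U] by (simp add: distr_distr comp_def)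
    finally show ?thesis by simp
  qed
  then have cR: "c R = dH2 j \<rho> \<nu>"
    using \<beta>(2)[OF R_rot] \<gamma>_MK by (simp add: MK_solutions_def)
  have INF_eq: "(INF R'\<in>rotations \<rho>. c R') = dH2 j \<rho> \<nu>"
    using cR ge R_rot by (intro antisym) (auto intro: INF_greatest INF_lower2)

  have uniq: "AE x in \<rho>. R0 x = R x" if R0: "R0 \<in> rotations \<rho>" and "c R0 = dH2 j \<rho> \<nu>" for R0
  proof -
    have "\<beta> R0 \<in> MK_solutions j \<rho> \<nu>"
      using \<beta>[OF R0] that by (simp add: MK_solutions_def)
    then have "\<beta> R0 = \<gamma>" using MK by simp
    with \<gamma>_conc have conc: "AE z in \<beta> R0. Tinv (snd z) = fst z" by (simp only:)
    have "(\<lambda>x. (R0 x, U x)) \<in> \<rho> \<rightarrow>\<^sub>M borel \<Otimes>\<^sub>M borel"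
      using R0 by (intro measurable_Pair \<rho>_meas U) (simp add: rotations_def)
    from AE_distrD[OF this conc[unfolded \<beta>_def]] have "AE x in \<rho>. Tinv (U x) = R0 x" by simp
    then show ?thesis by (simp add: R_eq eq_commute)
  qed
  have "AE x in \<rho>. U x = (T \<circ> R) x"
    using AE_U[OF TS] by (simp add: R_eq eq_commute)
  then show ?thesis
    using R_rot pert cR INF_eq uniq unfolding c_def by auto
qed

end
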